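(* Let $A$ be an $n\times n$ real matrix such that $D(A)\in\mathcal{D}$. Assume that $D(A)$ is strongly connected and $\Delta_A\neq 0$. Then $D(A^{\#})\in\mathcal{D}$ if and only if $D(A)$ is either a corona digraph or a star tree digraph.
   Context: The group inverse $A^{\#}$ of a real square matrix $A$ is, if it exists, the unique matrix $X$ with $AXA=A$, $XAX=X$, $AX=XA$ (under the hypotheses of the claim it exists). For $A=(a_{ij})\in\mathbb{R}^{n\times n}$, $D(A)$ is the digraph with vertex set $\{1,\dots,n\}$ in which $(i,j)$ is an edge iff $a_{ij}\neq 0$. A digraph is simple symmetric if it has no loops and, whenever $(i,j)$ is an edge, $(j,i)$ is also an edge. It is strongly connected if there is a (directed) path from each vertex to every other vertex. In a simple symmetric digraph, a 2-cycle $(i,j,i)$ (identified with $(j,i,j)$) is present for each pair of distinct vertices $i,j$ joined by edges; such $i,j$ are called adjacent and the 2-cycle is incident to $i$ and $j$. A vertex is pendant if it is incident to exactly one 2-cycle, and non-pendant otherwise. $\mathcal{D}$ is the class of simple symmetric digraphs in which each non-pendant vertex is adjacent to at least one pendant vertex. A simple symmetric digraph is a corona digraph if each non-pendant vertex is adjacent to exactly one pendant vertex. A tree digraph is a strongly connected digraph all of whose cycles have length 2; a star tree digraph is a tree digraph having a center vertex that is adjacent to all the other vertices (and there are no other adjacencies). A matching is a set of pairwise vertex-disjoint 2-cycles; a maximum matching is a matching of maximum cardinality. For a maximum matching $M$, its maximum matching product is the product of $a_{ij}a_{ji}$ over all 2-cycles $(i,j,i)\in M$. $\Delta_A$ is the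 sum of the maximum matching products over all maximum matchings of $D(A)$. *)

theory Defs
  imports
    "HOL-Analysis.Analysis"
    "Graph_Theory.Pair_Digraph"
    "Graph_Theory.Digraph_Component"
begin

section \<open>The group inverse\<close>

definition is_group_inverse :: "real ^ 'n ^ 'n \<Rightarrow> real ^ 'n ^ 'n \<Rightarrow> bool" where
  "is_group_inverse A X \<longleftrightarrow> A ** X ** A = A \<and> X ** A ** X = X \<and> A ** X = X ** A"

lemma is_group_inverse_unique:
  fixes A X Y :: "real ^ 'n ^ 'n"
  assumes X: "is_group_inverse A X" and Y: "is_group_inverse A Y"
  shows "X = Y"
proof -
  have x: "A ** X ** A = A" "X ** A ** X = X" "A ** X = X ** A"
    using X unfolding is_group_inverse_def by auto
  have y: "A ** Y ** A = A" "Y ** A ** Y = Y" "A ** Y = Y ** A"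
    using Y unfolding is_group_inverse_def by auto
  have "A ** X = (A ** Y) ** (A ** X)"
    using y(1) by (simp add: matrix_mul_assoc)
  also have "\<dots> = Y ** (A ** X ** A)"
    using x(3) y(3) by (metis matrix_mul_assoc)
  also have "\<dots> = A ** Y"
    using x(1) y(3) by simp
  finally have eq: "A ** X = A ** Y" .
  have "X = X ** (A ** Y)"
    using x(2) eq by (metis matrix_mul_assoc)
  also have "\<dots> = (A ** Y) ** Y"
    using x(3) eq by (metis matrix_mul_assoc)
  also have "\<dots> = Y"
    using y(2,3) by simp
  finally show ?thesis .
qed

text \<open>A meaningful value only if a group inverse exists, that is, if \<open>A\<close> and \<open>A ** A\<close>
  have the same rank.\<close>

definition group_inverse :: "real ^ 'n ^ 'n \<Rightarrow> real ^ 'n ^ 'n" where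
  "group_inverse A = (THE X. is_group_inverse A X)"

lemma group_inverse_eqI: "is_group_inverse A X \<Longrightarrow> group_inverse A = X"
  unfolding group_inverse_def by (blast intro: is_group_inverse_unique)


section \<open>Digraphs\<close>

definition matrix_digraph :: "real ^ 'n ^ 'n \<Rightarrow> 'n pair_pre_digraph" where
  "matrix_digraph A = \<lparr> pverts = UNIV, parcs = {(i, j). A $ i $ j \<noteq> 0} \<rparr>"

abbreviation simple_symmetric_digraph :: "'a pair_pre_digraph \<Rightarrow> bool" where
  "simple_symmetric_digraph G \<equiv> pair_bidirected_digraph G"

text \<open>Since the 2-cycles \<open>(i, j, i)\<close> and \<open>(j, i, j)\<close> are identified, a 2-cycle is represented
  by the unordered pair \<open>{i, j}\<close> of its distinct vertices; it is incident to its elements.\<close>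

definition two_cycles :: "'a pair_pre_digraph \<Rightarrow> 'a set set" where
  "two_cycles G = {{i, j} | i j. i \<noteq> j \<and> (i, j) \<in> parcs G \<and> (j, i) \<in> parcs G}"

definition adjacent :: "'a pair_pre_digraph \<Rightarrow> 'a \<Rightarrow> 'a \<Rightarrow> bool" where
  "adjacent G i j \<longleftrightarrow> {i, j} \<in> two_cycles G"

definition pendant :: "'a pair_pre_digraph \<Rightarrow> 'a \<Rightarrow> bool" where
  "pendant G v \<longleftrightarrow> v \<in> pverts G \<and> (\<exists>!c. c \<in> two_cycles G \<and> v \<in> c)"

definition class_D :: "'a pair_pre_digraph \<Rightarrow> bool" where
  "class_D G \<longleftrightarrow> simple_symmetric_digraph G \<and>
     (\<forall>v\<in>pverts G. \<not> pendant G v \<longrightarrow> (\<exists>w. pendant G w \<and> adjacent G v w))"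

definition corona_digraph :: "'a pair_pre_digraph \<Rightarrow> bool" where
  "corona_digraph G \<longleftrightarrow> simple_symmetric_digraph G \<and>
     (\<forall>v\<in>pverts G. \<not> pendant G v \<longrightarrow> (\<exists>!w. pendant G w \<and> adjacent G v w))"

text \<open>The library's cycles include loops, as cycles of length 1, so a tree digraph has no loops.\<close>

definition tree_digraph :: "'a pair_pre_digraph \<Rightarrow> bool" where
  "tree_digraph G \<longleftrightarrow> strongly_connected (with_proj G) \<and>
     (\<forall>p. pre_digraph.cycle (with_proj G) p \<longrightarrow> length p = 2)"

definition star_tree_digraph :: "'a pair_pre_digraph \<Rightarrow> bool" where
  "star_tree_digraph G \<longleftrightarrow> tree_digraph G \<and>
     (\<exists>c\<in>pverts G. (\<forall>v\<in>pverts G. v \<noteq> c \<longrightarrow> adjacent G c v) \<and>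
        (\<forall>u v. adjacent G u v \<longrightarrow> u = c \<or> v = c))"


section \<open>Maximum matchings\<close>

definition matching :: "'a pair_pre_digraph \<Rightarrow> 'a set set \<Rightarrow> bool" where
  "matching G M \<longleftrightarrow> M \<subseteq> two_cycles G \<and> pairwise disjnt M"

definition maximum_matching :: "'a pair_pre_digraph \<Rightarrow> 'a set set \<Rightarrow> bool" where
  "maximum_matching G M \<longleftrightarrow> matching G M \<and> (\<forall>M'. matching G M' \<longrightarrow> card M' \<le> card M)"

text \<open>For \<open>c = {i, j}\<close> with \<open>i \<noteq> j\<close>, the index set below consists of \<open>(i, j)\<close> and \<open>(j, i)\<close>.\<close>

definition two_cycle_product :: "real ^ 'n ^ 'n \<Rightarrow> 'n set \<Rightarrow> real" where
  "two_cycle_product A c = (\<Prod>(i, j)\<in>{(i, j). i \<noteq> j \<and> c = {i, j}}. A $ i $ j)"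

lemma two_cycle_product_pair:
  assumes "i \<noteq> j"
  shows "two_cycle_product A {i, j} = A $ i $ j * A $ j $ i"
proof -
  have "{(k, l). k \<noteq> l \<and> {i, j} = {k, l}} = {(i, j), (j, i)}"
    using assms by (auto simp: doubleton_eq_iff)
  with assms show ?thesis by (simp add: two_cycle_product_def)
qed

definition matching_product :: "real ^ 'n ^ 'n \<Rightarrow> 'n set set \<Rightarrow> real" where
  "matching_product A M = (\<Prod>c\<in>M. two_cycle_product A c)"

definition Delta :: "real ^ 'n ^ 'n \<Rightarrow> real" where
  "Delta A = (\<Sum>M\<in>{M. maximum_matching (matrix_digraph A) M}. matching_product A M)"

end

(* Let S consist of the non-pendant vertices (for the single 2-cycle, of one of its two vertices),
   so that A has block form [[B, R], [C, 0]]. Each pendant vertex has one neighbour, so R C is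
   diagonal with entries d(s), the sum of a_sp a_ps over the pendant neighbours p of s. A maximum
   matching chooses one pendant neighbour for each s in S, hence Delta_A is the product of the d(s).
   With D = R C the group inverse is [[0, D^-1 R], [C D^-1, - C D^-1 B D^-1 R]]. Its digraph moves
   the edges inside S to the corresponding pairs of pendant vertices. If S is a singleton, A is a
   star and the digraph does not change. Otherwise every s in S has a neighbour in S, so no vertex
   outside S stays pendant, and the vertices of S have to become pendant: this says that A is a
   corona. *)

theory Submission
  imports Defs
begin

section \<open>Digraphs of symmetrically patterned matrices\<close>

lemma matrix_digraph_simps [simp]:
  "pverts (matrix_digraph A) = UNIV"
  "parcs (matrix_digraph A) = {(i, j). A $ i $ j \<noteq> 0}"
  by (simp_all add: matrix_digraph_def)

lemma simple_symmetric_matrix_digraph_iff: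
  "simple_symmetric_digraph (matrix_digraph A) \<longleftrightarrow>
     (\<forall>i j. A $ i $ j \<noteq> 0 \<longrightarrow> A $ j $ i \<noteq> 0) \<and> (\<forall>i. A $ i $ i = 0)"
  by (auto simp: pair_bidirected_digraph_def pair_sym_digraph_def pair_loopfree_digraph_def
      pair_wf_digraph_def pair_sym_digraph_axioms_def pair_loopfree_digraph_axioms_def
      symmetric_def sym_def)

lemma transpose_entry: "transpose A $ i $ j = A $ j $ i"
  by (simp add: transpose_def)

context
  fixes A :: "real ^ 'n ^ 'n"
  assumes simple: "simple_symmetric_digraph (matrix_digraph A)"
begin

lemma entry_sym: "A $ i $ j \<noteq> 0 \<longleftrightarrow> A $ j $ i \<noteq> 0"
  and entry_diag: "A $ i $ i = 0"
  using simple by (auto simp: simple_symmetric_matrix_digraph_iff)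

lemma two_cycles_matrix_digraph:
  "two_cycles (matrix_digraph A) = {{i, j} | i j. A $ i $ j \<noteq> 0}"
  unfolding two_cycles_def using entry_sym entry_diag by fastforce

lemma adjacent_matrix_digraph: "adjacent (matrix_digraph A) i j \<longleftrightarrow> A $ i $ j \<noteq> 0"
  using entry_sym by (auto simp: adjacent_def two_cycles_matrix_digraph doubleton_eq_iff)

text \<open>Sending a neighbour \<open>w\<close> of \<open>v\<close> to \<open>{v, w}\<close> is a
  bijection onto the 2-cycles at \<open>v\<close>, so being pendant can be read off the support of
  row \<open>v\<close>.\<close>

lemma pendant_matrix_digraph: "pendant (matrix_digraph A) v \<longleftrightarrow> (\<exists>!w. A $ v $ w \<noteq> 0)"
proof -
  have "{c. c \<in> two_cycles (matrix_digraph A) \<and> v \<in> c} = (\<lambda>w. {v, w}) ` {w. A $ v $ w \<noteq> 0}"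
    using entry_sym by (auto simp: two_cycles_matrix_digraph)
  moreover have "inj_on (\<lambda>w. {v, w}) {w. A $ v $ w \<noteq> 0}"
    by (auto simp: inj_on_def doubleton_eq_iff)
  ultimately have "card {c. c \<in> two_cycles (matrix_digraph A) \<and> v \<in> c} =
      card {w. A $ v $ w \<noteq> 0}"
    by (simp add: card_image)
  then show ?thesis
    using is_singleton_iff_ex1[of "{c. c \<in> two_cycles (matrix_digraph A) \<and> v \<in> c}"]
      is_singleton_iff_ex1[of "{w. A $ v $ w \<noteq> 0}"]
    by (simp add: pendant_def is_singleton_iff_card_eq_Suc_0)
qed

lemma class_D_matrix_digraph:
  "class_D (matrix_digraph A) \<longleftrightarrow>
     (\<forall>v. \<not> (\<exists>!w. A $ v $ w \<noteq> 0) \<longrightarrow> (\<exists>p. (\<exists>!w. A $ p $ w \<noteq> 0) \<and> A $ v $ p \<noteq> 0))"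
  using simple by (simp add: class_D_def pendant_matrix_digraph adjacent_matrix_digraph)

lemma corona_matrix_digraph:
  "corona_digraph (matrix_digraph A) \<longleftrightarrow>
     (\<forall>v. \<not> (\<exists>!w. A $ v $ w \<noteq> 0) \<longrightarrow> (\<exists>!p. (\<exists>!w. A $ p $ w \<noteq> 0) \<and> A $ v $ p \<noteq> 0))"
  using simple by (simp add: corona_digraph_def pendant_matrix_digraph adjacent_matrix_digraph)

text \<open>Three consecutive arcs can all meet \<open>c\<close> only if \<open>c\<close> occurs
  twice among vertices that a cycle keeps distinct. Hence a cycle has fewer than three arcs, and the
  zero diagonal excludes loops.\<close>

lemma star_cycle_length:
  assumes star: "\<And>u v. A $ u $ v \<noteq> 0 \<Longrightarrow> u = c \<or> v = c"
    and cycle: "pre_digraph.cycle (with_proj (matrix_digraph A)) p"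
  shows "length p = 2"
proof -
  obtain u where arcs: "set p \<subseteq> {(i, j). A $ i $ j \<noteq> 0}" and cas: "pcas u p u"
    and dist: "distinct (tl (pawalk_verts u p))" and "p \<noteq> []"
    using cycle by (auto simp: pre_digraph.cycle_def pre_digraph.awalk_def cas_with_proj_eq
        awalk_verts_with_proj_eq)
  \<comment> \<open>\<open>tl\<close> drops only the first vertex, so the start \<open>u\<close> is
    still compared with the inner vertices as the end of the walk.\<close>
  have last: "pcas x q y \<Longrightarrow> y \<in> set (pawalk_verts x q)" for x y and q :: "('n \<times> 'n) list"
    by (induction q arbitrary: x) auto
  from \<open>p \<noteq> []\<close> obtain e q where p: "p = e # q" by (cases p) auto
  show ?thesis
  proof (cases q)
    case Nil
    with p arcs cas entry_diag show ?thesis by auto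
  next
    case q: (Cons e' q')
    show ?thesis
    proof (cases q')
      case Nil
      with p q show ?thesis by simp
    next
      case q': (Cons e'' r)
      obtain v w x where e: "e = (u, v)" "e' = (v, w)" "e'' = (w, x)" and rest: "pcas x r u"
        using cas p q q' by (cases e; cases e'; cases e'') auto
      have "u \<in> set (pawalk_verts x r)" "x \<in> set (pawalk_verts x r)"
        using last[OF rest] by (cases r; use rest in auto)+
      moreover have "v \<notin> set (pawalk_verts x r)" "w \<notin> set (pawalk_verts x r)" "v \<noteq> w"
        using dist p q q' e by auto
      moreover have "u = c \<or> v = c" "v = c \<or> w = c" "w = c \<or> x = c"
        using arcs p q q' e star by auto
      ultimately show ?thesis by metis
    qed
  qed
qed

end

text \<open>Induction along a path out of \<open>u\<close>. It serves to show that a single 2-cycle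
  or a star, once closed under arcs, is the whole digraph.\<close>

lemma strongly_connected_closed_eq_UNIV:
  assumes "strongly_connected (with_proj (matrix_digraph A))"
    and "u \<in> T" and closed: "\<And>x y. x \<in> T \<Longrightarrow> A $ x $ y \<noteq> 0 \<Longrightarrow> y \<in> T"
  shows "T = UNIV"
proof -
  have "v \<in> T" for v
  proof -
    have "reachable (with_proj (matrix_digraph A)) u v"
      using assms(1) by (simp add: strongly_connected_def)
    then have "(u, v) \<in> {(i, j). A $ i $ j \<noteq> 0}\<^sup>*"
      by (auto dest: reachable_rtranclI)
    then show ?thesis
      by induction (use assms in auto)
  qed
  then show ?thesis by auto
qed

section \<open>Matrices with pendant vertices attached to a core\<close>

text \<open>\<open>S\<close> is the core and \<open>f\<close> gives the only neighbour of a vertex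
  outside it; the values of \<open>f\<close> on \<open>S\<close> are arbitrary. A vertex of
  \<open>S\<close> may itself be pendant, as happens for a single 2-cycle.\<close>

locale pendant_cover =
  fixes A :: "real ^ 'n ^ 'n" and S :: "'n set" and f :: "'n \<Rightarrow> 'n"
  assumes simple: "simple_symmetric_digraph (matrix_digraph A)"
    and f_in: "p \<notin> S \<Longrightarrow> f p \<in> S"
    and pendant_entry: "p \<notin> S \<Longrightarrow> A $ p $ q \<noteq> 0 \<longleftrightarrow> q = f p"
    and covered: "s \<in> S \<Longrightarrow> \<exists>p. p \<notin> S \<and> f p = s"
begin

lemmas entry_sym = entry_sym[OF simple] and entry_diag = entry_diag[OF simple]

lemma pendant_entry': "p \<notin> S \<Longrightarrow> A $ q $ p \<noteq> 0 \<longleftrightarrow> q = f p"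
  using pendant_entry entry_sym by metis

section \<open>The group inverse in block form\<close>

definition d :: "'n \<Rightarrow> real" where
  "d s = (\<Sum>k\<in>-S. A $ s $ k * A $ k $ s)"

text \<open>For \<open>k\<close> outside \<open>S\<close>, a nonzero \<open>A $ s $ k\<close> forces
  \<open>f k = s\<close>, so \<open>g (f k)\<close> is constant on the support of the sum.\<close>

lemma sum_pendants:
  "(\<Sum>k\<in>-S. A $ s $ k * A $ k $ f k * g (f k)) = d s * g s"
  unfolding d_def sum_distrib_right
  by (intro sum.cong refl) (use pendant_entry' in \<open>metis ComplD mult_zero_left\<close>)

text \<open>In the block - C D^-1 B D^-1 R, row \<open>i\<close> of C and column \<open>j\<close> of
  R have a single nonzero entry each, so the double sum over \<open>S\<close> collapses to one
  term.\<close>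

definition inv_entry :: "'n \<Rightarrow> 'n \<Rightarrow> real" where
  "inv_entry i j =
    (if i \<in> S then if j \<in> S then 0 else A $ i $ j / d i
     else if j \<in> S then A $ i $ j / d j
     else - (A $ i $ f i * A $ f i $ f j * A $ f j $ j) / (d (f i) * d (f j)))"

definition X :: "real ^ 'n ^ 'n" where
  "X = (\<chi> i j. inv_entry i j)"

text \<open>The block diagonal matrix with blocks I and C D^-1 R, which is both
  \<open>A ** X\<close> and \<open>X ** A\<close> when \<open>d\<close> has no zero on
  \<open>S\<close>.\<close>

definition proj_entry :: "'n \<Rightarrow> 'n \<Rightarrow> real" where
  "proj_entry i j =
    (if i \<in> S \<or> j \<in> S then if i = j then 1 else 0 else A $ i $ f i * A $ f i $ j / d (f i))"

definition E :: "real ^ 'n ^ 'n" where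
  "E = (\<chi> i j. proj_entry i j)"

lemma pendant_row: "p \<notin> S \<Longrightarrow> (\<Sum>k\<in>UNIV. A $ p $ k * g k) = A $ p $ f p * g (f p)"
proof -
  assume "p \<notin> S"
  then have "(\<Sum>k\<in>UNIV. A $ p $ k * g k) = (\<Sum>k\<in>{f p}. A $ p $ k * g k)"
    by (intro sum.mono_neutral_right) (use pendant_entry in auto)
  then show ?thesis by simp
qed

lemma sum_split: "(\<Sum>k\<in>UNIV. g k) = (\<Sum>k\<in>S. g k) + (\<Sum>k\<in>-S. g k)" for g :: "'n \<Rightarrow> real"
  by (subst sum.union_disjoint[symmetric]) auto

lemma entry_into_core: "k \<notin> S \<Longrightarrow> A $ k $ t = A $ k $ f k * (if f k = t then 1 else 0)"
  using pendant_entry[of k t] by auto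

lemma sum_pendants_core: "(\<Sum>k\<in>-S. A $ s $ k * A $ k $ t) = (if s = t then d s else 0)"
proof -
  have "(\<Sum>k\<in>-S. A $ s $ k * A $ k $ t) =
      (\<Sum>k\<in>-S. A $ s $ k * A $ k $ f k * (if f k = t then 1 else 0))"
    by (intro sum.cong refl) (subst entry_into_core, auto)
  also have "\<dots> = d s * (if s = t then 1 else 0)"
    by (rule sum_pendants)
  finally show ?thesis by simp
qed

context
  assumes d_nonzero: "s \<in> S \<Longrightarrow> d s \<noteq> 0"
begin

lemma A_mult_X: "A ** X = E"
proof -
  have "(\<Sum>k\<in>UNIV. A $ i $ k * inv_entry k j) = proj_entry i j" for i j
  proof (cases "i \<in> S")
    case False
    then show ?thesis
      using f_in[of i] d_nonzero[of "f i"] pendant_entry[of i j]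
      by (auto simp: pendant_row inv_entry_def proj_entry_def)
  next
    case i: True
    show ?thesis
    proof (cases "j \<in> S")
      case True
      have "(\<Sum>k\<in>S. A $ i $ k * inv_entry k j) = 0"
        using True by (simp add: inv_entry_def)
      moreover have "(\<Sum>k\<in>-S. A $ i $ k * inv_entry k j) =
          (\<Sum>k\<in>-S. A $ i $ k * A $ k $ j) / d j"
        unfolding sum_divide_distrib using True by (intro sum.cong) (auto simp: inv_entry_def)
      ultimately show ?thesis
        using i True d_nonzero by (simp add: sum_split sum_pendants_core proj_entry_def)
    next
      case j: False
      \<comment> \<open>Only \<open>k = f j\<close> survives, leaving an entry of B D^-1 R; the sum
        over \<open>-S\<close> is its negative because R C = D.\<close>
      have "(\<Sum>k\<in>S. A $ i $ k * inv_entry k j) = (\<Sum>k\<in>{f j}. A $ i $ k * inv_entry k j)"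
        by (intro sum.mono_neutral_right) (use f_in pendant_entry' j in \<open>auto simp: inv_entry_def\<close>)
      then have core: "(\<Sum>k\<in>S. A $ i $ k * inv_entry k j) = A $ i $ f j * A $ f j $ j / d (f j)"
        using f_in j by (simp add: inv_entry_def)
      have "(\<Sum>k\<in>-S. A $ i $ k * inv_entry k j) =
          (\<Sum>k\<in>-S. A $ i $ k * A $ k $ f k * (- (A $ f k $ f j * A $ f j $ j) / (d (f k) * d (f j))))"
        using j by (intro sum.cong) (auto simp: inv_entry_def)
      also have "\<dots> = d i * (- (A $ i $ f j * A $ f j $ j) / (d i * d (f j)))"
        by (rule sum_pendants)
      finally show ?thesis
        using i j core d_nonzero by (auto simp: sum_split proj_entry_def)
    qed
  qed
  then show ?thesis
    by (simp add: matrix_matrix_mult_def vec_eq_iff X_def E_def)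
qed

text \<open>\<open>E\<close> fixes the rows in \<open>S\<close>. The assumptions say that the lower
  rows of \<open>Y\<close> are C times a matrix given by \<open>c\<close>, and that R maps them to D
  times that matrix; C D^-1 R therefore fixes them too.\<close>

lemma E_mult:
  assumes "\<And>i j. i \<notin> S \<Longrightarrow> (\<Sum>k\<in>-S. A $ f i $ k * Y $ k $ j) = d (f i) * c i j"
    and "\<And>i j. i \<notin> S \<Longrightarrow> Y $ i $ j = A $ i $ f i * c i j"
  shows "E ** Y = Y"
proof -
  have "(\<Sum>k\<in>UNIV. proj_entry i k * Y $ k $ j) = Y $ i $ j" for i j
  proof (cases "i \<in> S")
    case True
    then have "(\<Sum>k\<in>UNIV. proj_entry i k * Y $ k $ j) = (\<Sum>k\<in>{i}. proj_entry i k * Y $ k $ j)"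
      by (intro sum.mono_neutral_right) (auto simp: proj_entry_def)
    with True show ?thesis by (simp add: proj_entry_def)
  next
    case False
    have "(\<Sum>k\<in>UNIV. proj_entry i k * Y $ k $ j) = (\<Sum>k\<in>-S. proj_entry i k * Y $ k $ j)"
      by (intro sum.mono_neutral_right) (use False in \<open>auto simp: proj_entry_def\<close>)
    also have "\<dots> = A $ i $ f i / d (f i) * (\<Sum>k\<in>-S. A $ f i $ k * Y $ k $ j)"
      unfolding sum_distrib_left using False by (intro sum.cong) (auto simp: proj_entry_def)
    also have "\<dots> = Y $ i $ j"
      using False assms d_nonzero[OF f_in] by simp
    finally show ?thesis .
  qed
  then show ?thesis
    by (simp add: matrix_matrix_mult_def vec_eq_iff E_def)
qed

lemma E_mult_A: "E ** A = A"
proof (rule E_mult[where c = "\<lambda>i j. if f i = j then 1 else 0"])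
  show "(\<Sum>k\<in>-S. A $ f i $ k * A $ k $ j) = d (f i) * (if f i = j then 1 else 0)" for i j
    by (simp add: sum_pendants_core)
  show "i \<notin> S \<Longrightarrow> A $ i $ j = A $ i $ f i * (if f i = j then 1 else 0)" for i j
    by (rule entry_into_core)
qed

lemma E_mult_X: "E ** X = X"
proof (rule E_mult)
  \<comment> \<open>The lower rows of \<open>X\<close> with the factor C removed: the blocks D^-1
    and - D^-1 B D^-1 R.\<close>
  define h where "h s j = (if j \<in> S then (if s = j then 1 else 0) / d j
      else - (A $ s $ f j * A $ f j $ j) / (d s * d (f j)))" for s j
  show eq: "X $ i $ j = A $ i $ f i * h (f i) j" if "i \<notin> S" for i j
    using that entry_into_core[OF that, of j] by (simp add: X_def inv_entry_def h_def)
  show "(\<Sum>k\<in>-S. A $ f i $ k * X $ k $ j) = d (f i) * h (f i) j" for i j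
  proof -
    have "(\<Sum>k\<in>-S. A $ f i $ k * X $ k $ j) =
        (\<Sum>k\<in>-S. A $ f i $ k * A $ k $ f k * h (f k) j)"
      by (intro sum.cong refl) (simp add: eq)
    also have "\<dots> = d (f i) * h (f i) j"
      by (rule sum_pendants)
    finally show ?thesis .
  qed
qed

end

text \<open>The conditions depend only on the zero pattern, which is symmetric. This reduces
  \<open>X ** A\<close> to a product of the form already computed.\<close>

lemma pendant_cover_transpose: "pendant_cover (transpose A) S f"
proof (rule pendant_cover.intro)
  show "simple_symmetric_digraph (matrix_digraph (transpose A))"
    using simple by (auto simp: simple_symmetric_matrix_digraph_iff transpose_def)
qed (use f_in pendant_entry' covered in \<open>auto simp: transpose_def\<close>)

lemma is_group_inverse_X:
  assumes d_nonzero: "\<And>s. s \<in> S \<Longrightarrow> d s \<noteq> 0"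
  shows "is_group_inverse A X"
proof -
  interpret T: pendant_cover "transpose A" S f by (rule pendant_cover_transpose)
  have d: "T.d = d"
    by (simp add: fun_eq_iff T.d_def d_def transpose_entry mult.commute)
  have X: "T.X = transpose X"
    by (auto simp: T.X_def X_def T.inv_entry_def inv_entry_def d transpose_entry vec_eq_iff ac_simps)
  have E: "T.E = transpose E"
  proof -
    have "T.proj_entry i j = proj_entry j i" for i j
    \<comment> \<open>Two pendants with different neighbours give a zero entry of C D^-1 R in either
      order; with a common neighbour the formulas agree.\<close>
    proof (cases "i \<in> S \<or> j \<in> S \<or> f i = f j")
      case True
      then show ?thesis
        by (auto simp: T.proj_entry_def proj_entry_def d transpose_entry)
    next
      case False
      then have "A $ j $ f i = 0" "A $ f j $ i = 0"
        using pendant_entry[of j "f i"] pendant_entry'[of i "f j"] by auto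
      with False show ?thesis
        by (simp add: T.proj_entry_def proj_entry_def transpose_entry)
    qed
    then show ?thesis by (simp add: T.E_def E_def transpose_entry vec_eq_iff)
  qed
  have "transpose A ** transpose X = transpose E"
    using T.A_mult_X d_nonzero by (simp add: d X E)
  then have "X ** A = E"
    by (metis matrix_transpose_mul transpose_transpose)
  with d_nonzero show ?thesis
    by (simp add: is_group_inverse_def A_mult_X E_mult_A E_mult_X)
qed

section \<open>Maximum matchings as choices of pendant neighbours\<close>

definition pendants :: "'n \<Rightarrow> 'n set" where
  "pendants s = {p. p \<notin> S \<and> f p = s}"

definition edges :: "('n \<Rightarrow> 'n) \<Rightarrow> 'n set set" where
  "edges g = (\<lambda>s. {s, g s}) ` S"

text \<open>Both \<open>s\<close> and \<open>g s\<close> determine \<open>s\<close>, the latter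
  through \<open>f\<close>. Allowing two choices \<open>g\<close> and \<open>h\<close> covers both
  disjointness within one matching and the injectivity of \<open>edges\<close>.\<close>

lemma edge_inj:
  assumes "g \<in> Pi S pendants" "h \<in> Pi S pendants" "s \<in> S" "t \<in> S"
    and "{s, g s} \<inter> {t, h t} \<noteq> {}"
  shows "s = t"
proof -
  have "g s \<in> pendants s" "h t \<in> pendants t"
    using assms by auto
  with assms(3-5) show ?thesis
    by (auto simp: pendants_def)
qed

lemma card_edges: "g \<in> Pi S pendants \<Longrightarrow> card (edges g) = card S"
  unfolding edges_def by (rule card_image) (auto intro!: inj_onI edge_inj)

lemma matching_edges:
  assumes g: "g \<in> Pi S pendants"
  shows "matching (matrix_digraph A) (edges g)"
  unfolding matching_def
proof
  have "A $ s $ g s \<noteq> 0" if "s \<in> S" for s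
    using pendant_entry'[of "g s" s] Pi_mem[OF g that] by (auto simp: pendants_def)
  then show "edges g \<subseteq> two_cycles (matrix_digraph A)"
    by (auto simp: edges_def two_cycles_matrix_digraph[OF simple])
  show "pairwise disjnt (edges g)"
  proof (rule pairwiseI)
    fix b c assume "b \<in> edges g" "c \<in> edges g" "b \<noteq> c"
    then obtain s t where "s \<in> S" "b = {s, g s}" "t \<in> S" "c = {t, g t}" "s \<noteq> t"
      unfolding edges_def by auto
    then show "disjnt b c"
      using edge_inj[OF g g, of s t] unfolding disjnt_def by metis
  qed
qed

text \<open>No arc joins two vertices outside \<open>S\<close>. Each 2-cycle of a matching thus uses
  up a core vertex.\<close>

lemma two_cycle_meets_core:
  assumes "c \<in> two_cycles (matrix_digraph A)"
  shows "\<exists>s\<in>S. s \<in> c"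
proof -
  obtain i j where "c = {i, j}" "A $ i $ j \<noteq> 0"
    using assms by (auto simp: two_cycles_matrix_digraph[OF simple])
  then show ?thesis
    using f_in[of i] pendant_entry[of i j] by (cases "i \<in> S") auto
qed

text \<open>Picking a core vertex from each 2-cycle is injective by disjointness. In case of
  equality it is onto \<open>S\<close>, so no 2-cycle can afford two core vertices.\<close>

lemma matching_card_le:
  assumes M: "matching (matrix_digraph A) M"
  shows "card M \<le> card S"
    and "card M = card S \<Longrightarrow> M \<in> edges ` PiE S pendants"
proof -
  have "\<forall>c\<in>M. \<exists>s. s \<in> S \<and> s \<in> c"
    using M two_cycle_meets_core unfolding matching_def by blast
  then obtain g where g: "\<And>c. c \<in> M \<Longrightarrow> g c \<in> S" "\<And>c. c \<in> M \<Longrightarrow> g c \<in> c"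
    by metis
  have disj: "c = c'" if "c \<in> M" "c' \<in> M" "x \<in> c" "x \<in> c'" for c c' x
    using M that unfolding matching_def pairwise_def disjnt_def by blast
  have inj: "inj_on g M"
    using g disj by (metis inj_onI)
  show "card M \<le> card S"
    using inj g by (intro card_inj_on_le) auto
  assume card: "card M = card S"
  have surj: "g ` M = S"
    using g card by (intro card_subset_eq) (auto simp: card_image[OF inj])
  have "\<exists>p. p \<in> pendants s \<and> {s, p} \<in> M" if s: "s \<in> S" for s
  proof -
    obtain c where c: "c \<in> M" "g c = s"
      using surj s by blast
    then obtain i j where ij: "c = {i, j}" "A $ i $ j \<noteq> 0"
      using M by (auto simp: matching_def two_cycles_matrix_digraph[OF simple])
    have "s = i \<or> s = j"
      using g(2)[OF c(1)] c(2) ij(1) by auto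
    then obtain p where p: "c = {s, p}" "A $ s $ p \<noteq> 0"
      using ij entry_sym[of i j] by (metis insert_commute)
    \<comment> \<open>If \<open>p\<close> were in \<open>S\<close>, the 2-cycle that picks
      \<open>p\<close> would meet \<open>c\<close>, hence equal \<open>c\<close>, which picks
      \<open>s\<close>; then \<open>p = s\<close> contradicts the zero diagonal.\<close>
    have "p \<notin> S"
    proof
      assume "p \<in> S"
      then obtain c' where c': "c' \<in> M" "g c' = p"
        using surj by blast
      then have "c' = c"
        using disj[of c' c p] g(2)[of c'] c p by auto
      with c c' p entry_diag show False by auto
    qed
    then show ?thesis
      using c p pendant_entry'[of p s] by (auto simp: pendants_def)
  qed
  then obtain h where h: "\<And>s. s \<in> S \<Longrightarrow> h s \<in> pendants s" "\<And>s. s \<in> S \<Longrightarrow> {s, h s} \<in> M"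
    by metis
  have "edges h = M"
    using h card card_edges[of h] by (intro card_subset_eq) (auto simp: edges_def)
  then have "M = edges (restrict h S)"
    by (simp add: edges_def)
  moreover have "restrict h S \<in> PiE S pendants"
    using h by auto
  ultimately show "M \<in> edges ` PiE S pendants"
    by blast
qed

text \<open>Every core vertex has a pendant to choose, so the bound \<open>card S\<close> is
  attained and characterises the maximum.\<close>

lemma maximum_matchings:
  "{M. maximum_matching (matrix_digraph A) M} = edges ` PiE S pendants"
proof -
  obtain g where "\<And>s. s \<in> S \<Longrightarrow> g s \<in> pendants s"
    using covered unfolding pendants_def by (metis (mono_tags, lifting) mem_Collect_eq)
  then have "g \<in> Pi S pendants"
    by blast
  then have "matching (matrix_digraph A) (edges g)" "card (edges g) = card S"
    by (simp_all add: matching_edges card_edges)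
  then have "maximum_matching (matrix_digraph A) M \<longleftrightarrow>
      matching (matrix_digraph A) M \<and> card M = card S" for M
    unfolding maximum_matching_def using matching_card_le(1) by (metis order_antisym)
  then show ?thesis
    using matching_card_le(2) matching_edges card_edges by (auto simp: PiE_def)
qed

text \<open>\<open>PiE\<close> fixes the values outside \<open>S\<close> to
  \<open>undefined\<close>, so a matching determines its choice function completely.\<close>

lemma inj_on_edges: "inj_on edges (PiE S pendants)"
proof (rule inj_onI)
  fix g h
  assume g: "g \<in> PiE S pendants" and h: "h \<in> PiE S pendants" and eq: "edges g = edges h"
  show "g = h"
  proof (rule PiE_ext[OF g h])
    fix s assume s: "s \<in> S"
    then have "{s, g s} \<in> edges h"
      using eq by (auto simp: edges_def)
    then obtain t where t: "t \<in> S" "{s, g s} = {t, h t}"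
      by (auto simp: edges_def)
    then have "s = t"
      using edge_inj[of g h s t] g h s by auto
    with t show "g s = h s"
      by (auto simp: doubleton_eq_iff)
  qed
qed

text \<open>Distributivity: the sum over all choice functions of the products is the product over
  \<open>S\<close> of the sums over the pendants.\<close>

lemma Delta_eq: "Delta A = (\<Prod>s\<in>S. d s)"
proof -
  have d: "d s = (\<Sum>p\<in>pendants s. A $ s $ p * A $ p $ s)" for s
    unfolding d_def pendants_def
    by (intro sum.mono_neutral_right) (use pendant_entry' in auto)
  have prod: "matching_product A (edges g) = (\<Prod>s\<in>S. A $ s $ g s * A $ g s $ s)"
    if "g \<in> PiE S pendants" for g
  proof -
    have g: "g \<in> Pi S pendants"
      using that by auto
    have inj: "inj_on (\<lambda>s. {s, g s}) S"
      by (auto intro!: inj_onI edge_inj[OF g g])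
    have "s \<noteq> g s" if "s \<in> S" for s
      using Pi_mem[OF g that] that by (auto simp: pendants_def)
    then show ?thesis
      by (simp add: matching_product_def edges_def prod.reindex[OF inj] two_cycle_product_pair)
  qed
  have "Delta A = (\<Sum>g\<in>PiE S pendants. matching_product A (edges g))"
    by (simp add: Delta_def maximum_matchings sum.reindex[OF inj_on_edges])
  also have "\<dots> = (\<Sum>g\<in>PiE S pendants. \<Prod>s\<in>S. A $ s $ g s * A $ g s $ s)"
    by (intro sum.cong refl prod)
  also have "\<dots> = (\<Prod>s\<in>S. d s)"
    unfolding d by (rule prod_sum_PiE[symmetric]) simp_all
  finally show ?thesis .
qed

section \<open>The digraph of the group inverse\<close>

context
  assumes Delta_nonzero: "Delta A \<noteq> 0"
begin

lemma d_nonzero: "s \<in> S \<Longrightarrow> d s \<noteq> 0"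
  using Delta_nonzero by (auto simp: Delta_eq)

lemma group_inverse_eq: "group_inverse A = X"
  by (intro group_inverse_eqI is_group_inverse_X d_nonzero)

lemma X_core_entry: "s \<in> S \<Longrightarrow> X $ s $ j \<noteq> 0 \<longleftrightarrow> j \<notin> S \<and> f j = s"
  using pendant_entry'[of j s] d_nonzero by (auto simp: X_def inv_entry_def)

text \<open>Each entry of \<open>X\<close> is zero or a single quotient of products, so nothing can
  cancel and the pattern is visible in the formula.\<close>

lemma X_pendant_entry:
  assumes "p \<notin> S"
  shows "X $ p $ j \<noteq> 0 \<longleftrightarrow> (if j \<in> S then j = f p else A $ f p $ f j \<noteq> 0)"
  using assms f_in[of p] f_in[of j] pendant_entry[of p j] pendant_entry[of p "f p"]
    pendant_entry'[of j "f j"] d_nonzero[of "f p"] d_nonzero[of "f j"]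
  by (auto simp: X_def inv_entry_def)

lemma simple_X: "simple_symmetric_digraph (matrix_digraph X)"
  unfolding simple_symmetric_matrix_digraph_iff
proof (intro conjI allI impI)
  fix i j assume ij: "X $ i $ j \<noteq> 0"
  show "X $ j $ i \<noteq> 0"
    using ij X_core_entry[of i j] X_core_entry[of j i] X_pendant_entry[of i j]
      X_pendant_entry[of j i] entry_sym[of "f i" "f j"]
    by (cases "i \<in> S"; cases "j \<in> S") simp_all
next
  fix i show "X $ i $ i = 0"
    using X_core_entry[of i i] X_pendant_entry[of i i] entry_diag[of "f i"]
    by (cases "i \<in> S") auto
qed

text \<open>The block B is a single diagonal entry, hence zero, and \<open>X\<close> has the zero
  pattern of \<open>A\<close>. Both sides of the equivalence then hold.\<close>

lemma singleton_core:
  assumes "S = {c}"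
    and "class_D (matrix_digraph A)" "strongly_connected (with_proj (matrix_digraph A))"
  shows "class_D (matrix_digraph X)" and "star_tree_digraph (matrix_digraph A)"
proof -
  have fc: "f p = c" if "p \<noteq> c" for p
    using f_in[of p] that assms(1) by auto
  have star: "A $ i $ j \<noteq> 0 \<longleftrightarrow> i = c \<and> j \<noteq> c \<or> i \<noteq> c \<and> j = c" for i j
    using pendant_entry[of i j] pendant_entry'[of j i] fc entry_diag[of c] assms(1) by auto
  have "X $ i $ j \<noteq> 0 \<longleftrightarrow> A $ i $ j \<noteq> 0" for i j
    using X_core_entry[of i j] X_pendant_entry[of i j] fc star[of i j] entry_diag[of c] assms(1)
    by (cases "i = c"; cases "j = c") auto
  then show "class_D (matrix_digraph X)"
    using assms(2) by (simp add: class_D_matrix_digraph simple simple_X)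
  have "tree_digraph (matrix_digraph A)"
    unfolding tree_digraph_def using assms(3) star_cycle_length[OF simple, of c] star by blast
  then show "star_tree_digraph (matrix_digraph A)"
    using star by (auto simp: star_tree_digraph_def adjacent_matrix_digraph[OF simple])
qed

context
  assumes core_neighbour: "s \<in> S \<Longrightarrow> \<exists>t\<in>S. A $ s $ t \<noteq> 0"
begin

text \<open>In the digraph of \<open>X\<close> a vertex \<open>v\<close> outside \<open>S\<close> is
  joined to \<open>f v\<close> and to the pendants of a core neighbour of \<open>f v\<close>, so it
  is not pendant. Its only neighbour in \<open>S\<close> is \<open>f v\<close>, which must then be
  pendant, and \<open>f v\<close> is joined exactly to its old pendants.\<close>

lemma class_D_X_iff: "class_D (matrix_digraph X) \<longleftrightarrow> (\<forall>s\<in>S. \<exists>!p. p \<notin> S \<and> f p = s)"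
proof -
  have pend: "(\<exists>!w. X $ v $ w \<noteq> 0) \<longleftrightarrow> v \<in> S \<and> (\<exists>!p. p \<notin> S \<and> f p = v)" for v
  proof (cases "v \<in> S")
    case True
    then show ?thesis by (simp add: X_core_entry)
  next
    case v: False
    obtain t q where "t \<in> S" "A $ f v $ t \<noteq> 0" "q \<notin> S" "f q = t"
      using core_neighbour[OF f_in[OF v]] covered by blast
    then have "X $ v $ q \<noteq> 0" "X $ v $ f v \<noteq> 0" "q \<noteq> f v"
      using v f_in[OF v] by (auto simp: X_pendant_entry)
    with v show ?thesis by blast
  qed
  show ?thesis
  proof
    assume D: "class_D (matrix_digraph X)"
    show "\<forall>s\<in>S. \<exists>!p. p \<notin> S \<and> f p = s"
    proof
      fix s assume "s \<in> S"
      then obtain p where p: "p \<notin> S" "f p = s"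
        using covered by blast
      then have "\<exists>w. (w \<in> S \<and> (\<exists>!q. q \<notin> S \<and> f q = w)) \<and> X $ p $ w \<noteq> 0"
        using D unfolding class_D_matrix_digraph[OF simple_X] pend by simp
      then obtain w where w: "w \<in> S" "\<exists>!q. q \<notin> S \<and> f q = w" "X $ p $ w \<noteq> 0"
        by (elim exE conjE)
      with p have "w = s"
        by (simp add: X_pendant_entry)
      with w(2) show "\<exists>!p. p \<notin> S \<and> f p = s"
        by simp
    qed
  next
    assume unique: "\<forall>s\<in>S. \<exists>!p. p \<notin> S \<and> f p = s"
    show "class_D (matrix_digraph X)"
      unfolding class_D_matrix_digraph[OF simple_X] pend
    proof (intro allI impI exI)
      fix v assume "\<not> (v \<in> S \<and> (\<exists>!p. p \<notin> S \<and> f p = v))"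
      then have "v \<notin> S"
        using unique by blast
      then show "(f v \<in> S \<and> (\<exists>!p. p \<notin> S \<and> f p = f v)) \<and> X $ v $ f v \<noteq> 0"
        using unique f_in by (simp add: X_pendant_entry)
    qed
  qed
qed

text \<open>A core vertex has a neighbour in \<open>S\<close> and one outside, so \<open>S\<close>
  is exactly the set of non-pendant vertices.\<close>

lemma corona_iff: "corona_digraph (matrix_digraph A) \<longleftrightarrow> (\<forall>s\<in>S. \<exists>!p. p \<notin> S \<and> f p = s)"
proof -
  have pend: "(\<exists>!w. A $ v $ w \<noteq> 0) \<longleftrightarrow> v \<notin> S" for v
  proof (cases "v \<in> S")
    case True
    then obtain t p where "t \<in> S" "A $ v $ t \<noteq> 0" "p \<notin> S" "f p = v"
      using core_neighbour covered by blast
    then show ?thesis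
      using pendant_entry'[of p v] True by auto
  next
    case False
    then show ?thesis by (simp add: pendant_entry)
  qed
  have "p \<notin> S \<and> A $ s $ p \<noteq> 0 \<longleftrightarrow> p \<notin> S \<and> f p = s" for s p
    using pendant_entry'[of p s] by auto
  then show ?thesis
    unfolding corona_matrix_digraph[OF simple] pend by (simp add: Ball_def)
qed

text \<open>Two adjacent core vertices with a pendant each form a path on four vertices, and no
  vertex lies on all three of its edges.\<close>

lemma not_star:
  assumes "S \<noteq> {}"
  shows "\<not> star_tree_digraph (matrix_digraph A)"
proof
  assume "star_tree_digraph (matrix_digraph A)"
  then obtain c where c: "\<And>u v. A $ u $ v \<noteq> 0 \<Longrightarrow> u = c \<or> v = c"
    by (auto simp: star_tree_digraph_def adjacent_matrix_digraph[OF simple])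
  obtain s t where st: "s \<in> S" "t \<in> S" "A $ s $ t \<noteq> 0"
    using assms core_neighbour by blast
  obtain p q where pq: "p \<notin> S" "f p = s" "q \<notin> S" "f q = t"
    using covered st by meson
  then have "p = c \<or> s = c" "q = c \<or> t = c"
    using c[of p s] c[of q t] pendant_entry[of p s] pendant_entry[of q t] by simp_all
  moreover have "s \<noteq> t"
    using st(3) entry_diag by metis
  moreover note c[OF st(3)]
  ultimately show False
    using st(1,2) pq(1,3) by metis
qed

end

end

end

section \<open>Finding the core\<close>

lemma pendant_cover_exists:
  assumes D: "class_D (matrix_digraph A)"
    and conn: "strongly_connected (with_proj (matrix_digraph A))"
  obtains (singleton) c f where "pendant_cover A {c} f"
  | (neighbours) S f where "pendant_cover A S f" "S \<noteq> {}" "\<And>s. s \<in> S \<Longrightarrow> \<exists>t\<in>S. A $ s $ t \<noteq> 0"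
proof -
  have simple: "simple_symmetric_digraph (matrix_digraph A)"
    using D by (simp add: class_D_def)
  note sym = entry_sym[OF simple] and diag = entry_diag[OF simple]
  define P where "P v \<longleftrightarrow> (\<exists>!w. A $ v $ w \<noteq> 0)" for v
  define f where "f v = (THE w. A $ v $ w \<noteq> 0)" for v
  have f: "A $ v $ w \<noteq> 0 \<longleftrightarrow> w = f v" if v: "P v" for v w
  proof -
    obtain u where u: "A $ v $ u \<noteq> 0" "\<And>w. A $ v $ w \<noteq> 0 \<Longrightarrow> w = u"
      using v unfolding P_def by metis
    then have "f v = u"
      unfolding f_def by (intro the_equality)
    with u show ?thesis by metis
  qed
  show ?thesis
  proof (cases "\<exists>p q. P p \<and> P q \<and> A $ p $ q \<noteq> 0")
    case True
    then obtain p q where pq: "P p" "P q" "f p = q" "f q = p" "p \<noteq> q"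
      using f sym diag by metis
    \<comment> \<open>Two adjacent pendant vertices have no other neighbours, so they are the whole
      digraph, and \<open>p\<close> alone serves as the core.\<close>
    have "{p, q} = UNIV"
      by (rule strongly_connected_closed_eq_UNIV[OF conn]) (use pq f in auto)
    then have q: "x = q" if "x \<notin> {p}" for x
      using that by blast
    have "pendant_cover A {p} (\<lambda>_. p)"
    proof (rule pendant_cover.intro[OF simple])
      show "A $ x $ y \<noteq> 0 \<longleftrightarrow> y = p" if "x \<notin> {p}" for x y
        using q[OF that] f[OF pq(2)] pq(4) by simp
      show "\<exists>x. x \<notin> {p} \<and> p = s" if "s \<in> {p}" for s
        using that pq(5) by auto
    qed simp
    then show ?thesis by (rule singleton)
  next
    case False
    define S where "S = {v. \<not> P v}"
    have f_in: "f p \<in> S" if "p \<notin> S" for p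
      using that False f[of p "f p"] by (auto simp: S_def)
    have cover: "pendant_cover A S f"
    proof (rule pendant_cover.intro[OF simple f_in])
      fix s assume "s \<in> S"
      then obtain p where "P p" "A $ s $ p \<noteq> 0"
        using D unfolding class_D_matrix_digraph[OF simple] P_def[symmetric] S_def by blast
      then show "\<exists>p. p \<notin> S \<and> f p = s"
        using f sym by (auto simp: S_def)
    qed (auto simp: S_def f)
    have "S \<noteq> {}"
      using f_in by blast
    show ?thesis
    proof (cases "\<forall>s\<in>S. \<exists>t\<in>S. A $ s $ t \<noteq> 0")
      case True
      with cover \<open>S \<noteq> {}\<close> show ?thesis by (intro neighbours) auto
    next
      case False
      then obtain s where s: "s \<in> S" "\<And>t. t \<in> S \<Longrightarrow> A $ s $ t = 0"
        by blast
      \<comment> \<open>Without neighbours in \<open>S\<close>, the vertex \<open>s\<close> and its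
        pendants form a closed set, so the digraph is a star with centre \<open>s\<close>.\<close>
      have "insert s {p. p \<notin> S \<and> f p = s} = UNIV"
      proof (rule strongly_connected_closed_eq_UNIV[OF conn, of s])
        fix x y
        assume x: "x \<in> insert s {p. p \<notin> S \<and> f p = s}" and xy: "A $ x $ y \<noteq> 0"
        show "y \<in> insert s {p. p \<notin> S \<and> f p = s}"
        proof (cases "x = s")
          case True
          with xy s have "y \<notin> S" by auto
          moreover have "A $ y $ s \<noteq> 0"
            using xy True sym by blast
          ultimately show ?thesis
            using f[of y s] by (auto simp: S_def)
        next
          case False
          with x xy show ?thesis
            using f[of x y] by (auto simp: S_def)
        qed
      qed simp
      with s have "S = {s}" by blast
      with cover show ?thesis by (intro singleton) simp
    qed
  qed
qed

theorem theorem1p5: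
  fixes A :: "real ^ 'n ^ 'n"
  assumes "class_D (matrix_digraph A)"
    and "strongly_connected (with_proj (matrix_digraph A))"
    and "Delta A \<noteq> 0"
  shows "class_D (matrix_digraph (group_inverse A)) \<longleftrightarrow>
    corona_digraph (matrix_digraph A) \<or> star_tree_digraph (matrix_digraph A)"
  using assms(1,2)
proof (cases rule: pendant_cover_exists)
  case (singleton c f)
  then interpret pendant_cover A "{c}" f .
  show ?thesis
    using singleton_core[OF assms(3) refl assms(1,2)] by (simp add: group_inverse_eq assms(3))
next
  case (neighbours S f)
  then interpret pendant_cover A S f by simp
  \<comment> \<open>Both sides amount to each core vertex having exactly one pendant, since a star
    is impossible here.\<close>
  show ?thesis
    using class_D_X_iff corona_iff not_star neighbours assms(3) by (simp add: group_inverse_eq)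
qed

end
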